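(* Let $X,Y$ be completely regular Hausdorff spaces and let $\mathscr{P},\mathscr{Q}$ be ideals of closed sets in $X$ and $Y$ respectively. Let $\phi: G(C_\mathscr{P}(X))\to G(C_\mathscr{Q}(Y))$ be a graph isomorphism satisfying $|[f]_X|=|[\phi(f)]_Y|$ for all $f\in V(C_\mathscr{P}(X))$. Then $\phi$ can be extended to a graph isomorphism between $AG(C_\mathscr{P}(X))$ and $AG(C_\mathscr{Q}(Y))$.
   Context: $C(X)$ is the ring of all real valued continuous functions on $X$; $Z(f)=\{x\in X: f(x)=0\}$. An ideal of closed sets in $X$ is a nonempty family $\mathscr{P}$ of closed subsets of $X$ such that $A,B\in\mathscr{P}$ implies $A\cup B\in\mathscr{P}$, and $A\in\mathscr{P}$, $C\subset A$ with $C$ closed in $X$ implies $C\in\mathscr{P}$. $C_\mathscr{P}(X)=\{f\in C(X): cl_X(X\setminus Z(f))\in\mathscr{P}\}$, a commutative ring (possibly without identity). $X_\mathscr{P}$ is the set of all $x\in X$ having an open neighborhood $V$ with $cl_XV\in\mathscr{P}$. For a commutative ring $R$, $Z(R)^*$ is the set of nonzero zero divisors, i.e. nonzero $a\in R$ with $ab=0$ for some nonzero $b\in R$, and $ann(a)=\{r\in R: ra=0\}$. The annihilator graph $AG(R)$ is the simple graph with vertex set $Z(R)^*$ in which distinct $a,b$ are adjacent iff $ann(a)\cup ann(b)\neq ann(ab)$. On $C_\mathscr{P}(X)$ define the equivalence relation $f\sim_X g$ iff $int_XZ(f)\cap X_\mathscr{P}=int_XZ(g)\cap X_\mathscr{P}$,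 with classes $[f]_X$. Fix a set $S\subset C_\mathscr{P}(X)$ containing exactly one element of each class, and put $V(C_\mathscr{P}(X))=\{f\in S\setminus\{0\}: int_XZ(f)\cap X_\mathscr{P}\neq\emptyset\}$, a subset of $Z(C_\mathscr{P}(X))^*$. $G(C_\mathscr{P}(X))$ is the induced subgraph of $AG(C_\mathscr{P}(X))$ with vertex set $V(C_\mathscr{P}(X))$. The same definitions apply to $(Y,\mathscr{Q})$, with classes $[g]_Y$. $|\cdot|$ denotes cardinality. *)

theory Defs
  imports "HOL-Analysis.Analysis" "HOL-Algebra.Ring"
begin

no_notation eq_closure_of (\<open>closure'_of\<index>\<close>)

section \<open>Simple graphs\<close>

record 'v sgraph =
  vertices :: "'v set"
  edges :: "'v set set"

definition induced_sgraph :: "'v sgraph \<Rightarrow> 'v set \<Rightarrow> 'v sgraph" where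
  "induced_sgraph G W = \<lparr>vertices = W, edges = {e \<in> edges G. e \<subseteq> W}\<rparr>"

definition sgraph_iso :: "'v sgraph \<Rightarrow> 'w sgraph \<Rightarrow> ('v \<Rightarrow> 'w) \<Rightarrow> bool" where
  "sgraph_iso G H \<phi> \<longleftrightarrow>
     bij_betw \<phi> (vertices G) (vertices H) \<and>
     (\<forall>u\<in>vertices G. \<forall>v\<in>vertices G. {u, v} \<in> edges G \<longleftrightarrow> {\<phi> u, \<phi> v} \<in> edges H)"


section \<open>The annihilator graph of a commutative ring\<close>

text \<open>The rings in question need not have an identity, so the following definitions
  do not refer to the field \<^const>\<open>one\<close> of the ring record.\<close>

definition nonzero_zero_divisors :: "('r, 'm) ring_scheme \<Rightarrow> 'r set" where
  "nonzero_zero_divisors R =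
     {a \<in> carrier R. a \<noteq> \<zero>\<^bsub>R\<^esub> \<and> (\<exists>b\<in>carrier R. b \<noteq> \<zero>\<^bsub>R\<^esub> \<and> a \<otimes>\<^bsub>R\<^esub> b = \<zero>\<^bsub>R\<^esub>)}"

definition annihilator :: "('r, 'm) ring_scheme \<Rightarrow> 'r \<Rightarrow> 'r set" where
  "annihilator R a = {r \<in> carrier R. r \<otimes>\<^bsub>R\<^esub> a = \<zero>\<^bsub>R\<^esub>}"

definition annihilator_graph :: "('r, 'm) ring_scheme \<Rightarrow> 'r sgraph" where
  "annihilator_graph R =
     \<lparr>vertices = nonzero_zero_divisors R,
      edges = {{a, b} | a b.
        a \<in> nonzero_zero_divisors R \<and> b \<in> nonzero_zero_divisors R \<and> a \<noteq> b \<and>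
        annihilator R a \<union> annihilator R b \<noteq> annihilator R (a \<otimes>\<^bsub>R\<^esub> b)}\<rparr>"


section \<open>Continuous functions with support in an ideal of closed sets\<close>

definition closed_set_ideal :: "'a topology \<Rightarrow> 'a set set \<Rightarrow> bool" where
  "closed_set_ideal X P \<longleftrightarrow>
     P \<noteq> {} \<and> (\<forall>A\<in>P. closedin X A) \<and>
     (\<forall>A\<in>P. \<forall>B\<in>P. A \<union> B \<in> P) \<and>
     (\<forall>A\<in>P. \<forall>C. C \<subseteq> A \<and> closedin X C \<longrightarrow> C \<in> P)"

definition zero_set :: "'a topology \<Rightarrow> ('a \<Rightarrow> real) \<Rightarrow> 'a set" where
  "zero_set X f = {x \<in> topspace X. f x = 0}"

text \<open>A real function on \<open>X\<close> is represented by the HOL function that is \<^const>\<open>undefined\<close>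
  outside \<^term>\<open>topspace X\<close>, so that equal functions on \<open>X\<close> are equal HOL functions.\<close>

definition cont_functions :: "'a topology \<Rightarrow> ('a \<Rightarrow> real) set" where
  "cont_functions X = {f \<in> extensional (topspace X). continuous_map X euclideanreal f}"

definition CP :: "'a topology \<Rightarrow> 'a set set \<Rightarrow> ('a \<Rightarrow> real) set" where
  "CP X P = {f \<in> cont_functions X. X closure_of (topspace X - zero_set X f) \<in> P}"

text \<open>The field \<^const>\<open>one\<close> is required by the record type; it need not belong to the carrier.\<close>

definition CP_ring :: "'a topology \<Rightarrow> 'a set set \<Rightarrow> ('a \<Rightarrow> real) ring" where
  "CP_ring X P =
     \<lparr>carrier = CP X P,
      mult = (\<lambda>f g. \<lambda>x\<in>topspace X. f x * g x),
      one = (\<lambda>x\<in>topspace X. 1),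
      zero = (\<lambda>x\<in>topspace X. 0),
      add = (\<lambda>f g. \<lambda>x\<in>topspace X. f x + g x)\<rparr>"

definition ideal_points :: "'a topology \<Rightarrow> 'a set set \<Rightarrow> 'a set" where
  "ideal_points X P = {x. \<exists>V. openin X V \<and> x \<in> V \<and> X closure_of V \<in> P}"

definition CP_equiv :: "'a topology \<Rightarrow> 'a set set \<Rightarrow> (('a \<Rightarrow> real) \<times> ('a \<Rightarrow> real)) set" where
  "CP_equiv X P = {(f, g). f \<in> CP X P \<and> g \<in> CP X P \<and>
     X interior_of (zero_set X f) \<inter> ideal_points X P
       = X interior_of (zero_set X g) \<inter> ideal_points X P}"

definition CP_class :: "'a topology \<Rightarrow> 'a set set \<Rightarrow> ('a \<Rightarrow> real) \<Rightarrow> ('a \<Rightarrow> real) set" where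
  "CP_class X P f = CP_equiv X P `` {f}"

definition CP_transversal :: "'a topology \<Rightarrow> 'a set set \<Rightarrow> ('a \<Rightarrow> real) set \<Rightarrow> bool" where
  "CP_transversal X P S \<longleftrightarrow>
     S \<subseteq> CP X P \<and> (\<forall>K \<in> CP X P // CP_equiv X P. \<exists>!f. f \<in> S \<and> f \<in> K)"

definition CP_vertices :: "'a topology \<Rightarrow> 'a set set \<Rightarrow> ('a \<Rightarrow> real) set \<Rightarrow> ('a \<Rightarrow> real) set" where
  "CP_vertices X P S =
     {f \<in> S - {\<zero>\<^bsub>CP_ring X P\<^esub>}. X interior_of (zero_set X f) \<inter> ideal_points X P \<noteq> {}}"

definition CP_graph :: "'a topology \<Rightarrow> 'a set set \<Rightarrow> ('a \<Rightarrow> real) set \<Rightarrow> ('a \<Rightarrow> real) sgraph" where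
  "CP_graph X P S = induced_sgraph (annihilator_graph (CP_ring X P)) (CP_vertices X P S)"


section \<open>Basic consistency facts\<close>

lemma equiv_CP_equiv: "equiv (CP X P) (CP_equiv X P)"
  by (auto simp: equiv_def refl_on_def sym_def trans_def CP_equiv_def)

lemma CP_I:
  assumes P: "closed_set_ideal X P" and "f \<in> extensional (topspace X)"
    and "continuous_map X euclideanreal f"
    and "A \<in> P" and sub: "topspace X - zero_set X f \<subseteq> A"
  shows "f \<in> CP X P"
proof -
  have "closedin X A" using P \<open>A \<in> P\<close> by (simp add: closed_set_ideal_def)
  then have "X closure_of (topspace X - zero_set X f) \<subseteq> A"
    using sub by (simp add: closure_of_minimal)
  then have "X closure_of (topspace X - zero_set X f) \<in> P"
    using P \<open>A \<in> P\<close> unfolding closed_set_ideal_def by (meson closedin_closure_of)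
  then show ?thesis using assms by (simp add: CP_def cont_functions_def)
qed

lemma CP_D:
  assumes "f \<in> CP X P"
  obtains A where "f \<in> extensional (topspace X)" "continuous_map X euclideanreal f"
    "A \<in> P" "topspace X - zero_set X f \<subseteq> A"
proof
  show "X closure_of (topspace X - zero_set X f) \<in> P" using assms by (simp add: CP_def)
  show "topspace X - zero_set X f \<subseteq> X closure_of (topspace X - zero_set X f)"
    by (simp add: closure_of_subset)
qed (use assms in \<open>auto simp: CP_def cont_functions_def\<close>)

lemma continuous_map_restrict_topspace:
  "continuous_map X Y f \<Longrightarrow> continuous_map X Y (restrict f (topspace X))"
  by (erule continuous_map_eq) simp

lemma CP_zero: assumes P: "closed_set_ideal X P" shows "(\<lambda>x\<in>topspace X. 0) \<in> CP X P"
proof -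
  obtain A where A: "A \<in> P" using P by (auto simp: closed_set_ideal_def)
  show ?thesis
  proof (rule CP_I[OF P _ _ A])
    show "continuous_map X euclideanreal (\<lambda>x\<in>topspace X. 0)"
      by (rule continuous_map_restrict_topspace) simp
  qed (simp_all add: zero_set_def)
qed

lemma CP_add:
  assumes P: "closed_set_ideal X P" and f: "f \<in> CP X P" and g: "g \<in> CP X P"
  shows "(\<lambda>x\<in>topspace X. f x + g x) \<in> CP X P"
proof -
  obtain A where "f \<in> extensional (topspace X)"
    and A: "continuous_map X euclideanreal f" "A \<in> P" "topspace X - zero_set X f \<subseteq> A"
    using f by (rule CP_D)
  obtain B where "g \<in> extensional (topspace X)"
    and B: "continuous_map X euclideanreal g" "B \<in> P" "topspace X - zero_set X g \<subseteq> B"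
    using g by (rule CP_D)
  have AB: "A \<union> B \<in> P" using P A(2) B(2) unfolding closed_set_ideal_def by blast
  show ?thesis
  proof (rule CP_I[OF P _ _ AB])
    show "continuous_map X euclideanreal (\<lambda>x\<in>topspace X. f x + g x)"
      by (rule continuous_map_restrict_topspace, rule continuous_map_add) (fact A(1) B(1))+
    have "topspace X - zero_set X (\<lambda>x\<in>topspace X. f x + g x)
        \<subseteq> (topspace X - zero_set X f) \<union> (topspace X - zero_set X g)"
      by (auto simp: zero_set_def)
    with A(3) B(3) show "topspace X - zero_set X (\<lambda>x\<in>topspace X. f x + g x) \<subseteq> A \<union> B"
      by blast
  qed simp
qed

lemma CP_mult_cont:
  assumes P: "closed_set_ideal X P" and g: "continuous_map X euclideanreal g" and f: "f \<in> CP X P"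
  shows "(\<lambda>x\<in>topspace X. g x * f x) \<in> CP X P"
proof -
  obtain A where "f \<in> extensional (topspace X)"
    and A: "continuous_map X euclideanreal f" "A \<in> P" "topspace X - zero_set X f \<subseteq> A"
    using f by (rule CP_D)
  show ?thesis
  proof (rule CP_I[OF P _ _ A(2)])
    show "continuous_map X euclideanreal (\<lambda>x\<in>topspace X. g x * f x)"
      by (rule continuous_map_restrict_topspace, rule continuous_map_real_mult) (fact g A(1))+
    have "topspace X - zero_set X (\<lambda>x\<in>topspace X. g x * f x) \<subseteq> topspace X - zero_set X f"
      by (auto simp: zero_set_def)
    with A(3) show "topspace X - zero_set X (\<lambda>x\<in>topspace X. g x * f x) \<subseteq> A" by blast
  qed simp
qed

lemma CP_mult:
  assumes "closed_set_ideal X P" "f \<in> CP X P" "g \<in> CP X P"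
  shows "(\<lambda>x\<in>topspace X. f x * g x) \<in> CP X P"
proof (rule CP_mult_cont)
  show "continuous_map X euclideanreal f" using assms(2) by (simp add: CP_def cont_functions_def)
qed (use assms in simp_all)

lemma abelian_group_CP_ring:
  assumes P: "closed_set_ideal X P"
  shows "abelian_group (CP_ring X P)"
proof (rule abelian_groupI)
  fix f assume f: "f \<in> carrier (CP_ring X P)"
  then have f': "f \<in> CP X P" by (simp add: CP_ring_def)
  then have "f \<in> extensional (topspace X)" by (simp add: CP_def cont_functions_def)
  then show "\<zero>\<^bsub>CP_ring X P\<^esub> \<oplus>\<^bsub>CP_ring X P\<^esub> f = f"
    by (auto simp: CP_ring_def fun_eq_iff extensional_def)
  have "(\<lambda>x\<in>topspace X. (-1) * f x) \<in> CP X P"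
    by (rule CP_mult_cont[OF P _ f']) simp
  then show "\<exists>g\<in>carrier (CP_ring X P). g \<oplus>\<^bsub>CP_ring X P\<^esub> f = \<zero>\<^bsub>CP_ring X P\<^esub>"
    by (intro bexI[of _ "\<lambda>x\<in>topspace X. (-1) * f x"])
       (auto simp: CP_ring_def fun_eq_iff)
qed (simp_all add: P CP_ring_def CP_add CP_zero ac_simps cong: restrict_cong)

lemma CP_ring_mult:
  assumes "closed_set_ideal X P"
    and "f \<in> carrier (CP_ring X P)" "g \<in> carrier (CP_ring X P)" "h \<in> carrier (CP_ring X P)"
  shows "f \<otimes>\<^bsub>CP_ring X P\<^esub> g \<in> carrier (CP_ring X P)"
    and "f \<otimes>\<^bsub>CP_ring X P\<^esub> g = g \<otimes>\<^bsub>CP_ring X P\<^esub> f"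
    and "(f \<otimes>\<^bsub>CP_ring X P\<^esub> g) \<otimes>\<^bsub>CP_ring X P\<^esub> h = f \<otimes>\<^bsub>CP_ring X P\<^esub> (g \<otimes>\<^bsub>CP_ring X P\<^esub> h)"
    and "(f \<oplus>\<^bsub>CP_ring X P\<^esub> g) \<otimes>\<^bsub>CP_ring X P\<^esub> h
           = (f \<otimes>\<^bsub>CP_ring X P\<^esub> h) \<oplus>\<^bsub>CP_ring X P\<^esub> (g \<otimes>\<^bsub>CP_ring X P\<^esub> h)"
  using assms by (auto simp: CP_ring_def CP_mult fun_eq_iff algebra_simps)

lemma CP_vertices_subset:
  assumes X: "completely_regular_space X" and P: "closed_set_ideal X P"
    and S: "CP_transversal X P S"
  shows "CP_vertices X P S \<subseteq> nonzero_zero_divisors (CP_ring X P)"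
proof
  fix f assume f: "f \<in> CP_vertices X P S"
  then obtain x V U where V: "openin X V" "x \<in> V" "X closure_of V \<in> P"
    and U: "openin X U" "x \<in> U" "U \<subseteq> zero_set X f"
    by (auto simp: CP_vertices_def ideal_points_def interior_of_def)
  have "openin X (U \<inter> V)" "x \<in> U \<inter> V"
    using U V by auto
  then obtain g :: "'a \<Rightarrow> real" where "continuous_map X euclideanreal g" "g x = 1"
      "g ` (topspace X - U \<inter> V) \<subseteq> {0}"
    using iffD1[OF completely_regular_space_gen_alt'[of "1::real" 0 X] X] by (metis zero_neq_one)
  note g = this(1,2)
  have g0: "\<And>y. y \<in> topspace X - U \<inter> V \<Longrightarrow> g y = 0"
    using \<open>g ` (topspace X - U \<inter> V) \<subseteq> {0}\<close> by blast
  let ?g = "restrict g (topspace X)"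
  have xX: "x \<in> topspace X" using V openin_subset by blast
  have g': "?g \<in> CP X P"
  proof (rule CP_I[OF P _ _ V(3)])
    have "V \<subseteq> X closure_of V" by (simp add: V(1) closure_of_subset openin_subset)
    then show "topspace X - zero_set X ?g \<subseteq> X closure_of V"
      using g0 by (auto simp: zero_set_def)
  qed (auto intro: continuous_map_restrict_topspace g)
  have "?g \<noteq> \<zero>\<^bsub>CP_ring X P\<^esub>"
  proof
    assume "?g = \<zero>\<^bsub>CP_ring X P\<^esub>"
    then have "?g x = 0" using xX by (simp add: CP_ring_def)
    then show False using xX g(2) by simp
  qed
  moreover have "f \<otimes>\<^bsub>CP_ring X P\<^esub> ?g = \<zero>\<^bsub>CP_ring X P\<^esub>"
    using g0 U(3) by (auto simp: CP_ring_def fun_eq_iff zero_set_def)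
  moreover have "f \<in> CP X P" "f \<noteq> \<zero>\<^bsub>CP_ring X P\<^esub>"
    using f S by (auto simp: CP_vertices_def CP_transversal_def)
  ultimately show "f \<in> nonzero_zero_divisors (CP_ring X P)"
    using g' unfolding nonzero_zero_divisors_def by (auto simp: CP_ring_def simp del: restrict_apply)
qed

end

theory Submission
  imports Defs
begin

text \<open>
  The annihilator graph of \<^term>\<open>CP_ring X P\<close> is a blow-up of the small graph
  \<^term>\<open>CP_graph X P S\<close>, in which each vertex \<open>f\<close> is replaced by an independent set of twins, its
  class \<^term>\<open>CP_class X P f\<close>.

  The cozero set of a member \<open>r\<close> of the ring is open and lies in \<^term>\<open>ideal_points X P\<close>. Hence \<open>r\<close>
  annihilates \<open>f\<close> precisely when this cozero set is contained in
  \<^term>\<open>X interior_of (zero_set X f) \<inter> ideal_points X P\<close> (lemma \<open>annihilator_CP_ring_iff\<close>).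
  Equivalent functions therefore have the same annihilator. The annihilator of a product is
  determined by the annihilators of its factors, so adjacency of \<open>a\<close> and \<open>b\<close> depends only on their
  classes, and two distinct members of one class are never adjacent because the ring is reduced
  (lemma \<open>annihilator_graph_edge_iff\<close>). Finally, being a nonzero zero divisor is also a property of
  the class, and the classes that have it are those represented in
  \<^term>\<open>CP_vertices X P S\<close>: complete regularity provides a nonzero function whose cozero set
  lies in the nonempty open set that defines such a class, and this function annihilates the
  members of the class. So sending a vertex to the representative of its class retracts
  the annihilator graph onto \<^term>\<open>CP_graph X P S\<close>, preserving and reflecting edges
  (lemma \<open>twin_retraction_CP_representative\<close>).

  Given such retractions on both sides, an isomorphism \<open>\<phi>\<close> of the small graphs extends by
  any choice of bijections between corresponding fibres, which are the classes of \<open>f\<close> and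
  \<open>\<phi> f\<close> and have equal cardinality, as long as the bijection on the fibre of
  \<open>f\<close> sends \<open>f\<close> to \<open>\<phi> f\<close> (lemma \<open>sgraph_iso_extend_along_twin_retractions\<close>).
\<close>

section \<open>Graphs that are blow-ups of an induced subgraph\<close>

lemma eqpoll_imp_pointed_bij_betw:
  assumes "A \<approx> B" and a: "a \<in> A" and b: "b \<in> B"
  shows "\<exists>h. bij_betw h A B \<and> h a = b"
proof -
  obtain h where h: "bij_betw h A B"
    using assms(1) by (auto simp: eqpoll_def)
  \<comment> \<open>Correct an arbitrary bijection by exchanging the value at \<open>a\<close> with the desired one.\<close>
  define k where "k = Transposition.transpose (h a) b"
  have "h a \<in> B" using h a by (auto simp: bij_betw_def)
  then have "k permutes B" unfolding k_def using b by (rule permutes_swap_id)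
  then have "bij_betw (k \<circ> h) A B"
    using h bij_betw_trans permutes_imp_bij by blast
  moreover have "(k \<circ> h) a = b" by (simp add: k_def)
  ultimately show ?thesis by blast
qed

text \<open>Requiring \<open>\<rho>\<close> to reflect edges as well as to preserve them makes each fibre
  independent when the graph has no loops.\<close>

definition twin_retraction :: "'v sgraph \<Rightarrow> 'v set \<Rightarrow> ('v \<Rightarrow> 'v) \<Rightarrow> bool" where
  "twin_retraction G V \<rho> \<longleftrightarrow>
     V \<subseteq> vertices G \<and> (\<forall>a\<in>vertices G. \<rho> a \<in> V) \<and> (\<forall>f\<in>V. \<rho> f = f) \<and>
     (\<forall>a\<in>vertices G. \<forall>b\<in>vertices G. {a, b} \<in> edges G \<longleftrightarrow> {\<rho> a, \<rho> b} \<in> edges G)"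

text \<open>Fibrewise bijections glue to a bijection \<open>\<psi>\<close> with \<open>\<sigma> (\<psi> a) = \<phi> (\<rho> a)\<close>, so both the edge
  \<open>{a, b}\<close> and the edge \<open>{\<psi> a, \<psi> b}\<close> can be read off in the small graphs, where \<open>\<phi>\<close> matches them.\<close>

lemma sgraph_iso_extend_along_twin_retractions:
  assumes \<rho>: "twin_retraction G V \<rho>" and \<sigma>: "twin_retraction H W \<sigma>"
    and iso: "sgraph_iso (induced_sgraph G V) (induced_sgraph H W) \<phi>"
    and fibres: "\<And>f. f \<in> V \<Longrightarrow> {a \<in> vertices G. \<rho> a = f} \<approx> {b \<in> vertices H. \<sigma> b = \<phi> f}"
  shows "\<exists>\<psi>. sgraph_iso G H \<psi> \<and> (\<forall>f\<in>V. \<psi> f = \<phi> f)"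
proof -
  have VG: "V \<subseteq> vertices G" and \<rho>V: "\<And>a. a \<in> vertices G \<Longrightarrow> \<rho> a \<in> V"
    and \<rho>_id: "\<And>f. f \<in> V \<Longrightarrow> \<rho> f = f"
    and \<rho>_edge: "\<And>a b. a \<in> vertices G \<Longrightarrow> b \<in> vertices G \<Longrightarrow>
                   {a, b} \<in> edges G \<longleftrightarrow> {\<rho> a, \<rho> b} \<in> edges G"
    using \<rho> unfolding twin_retraction_def by blast+
  have WH: "W \<subseteq> vertices H" and \<sigma>W: "\<And>b. b \<in> vertices H \<Longrightarrow> \<sigma> b \<in> W"
    and \<sigma>_id: "\<And>g. g \<in> W \<Longrightarrow> \<sigma> g = g"
    and \<sigma>_edge: "\<And>a b. a \<in> vertices H \<Longrightarrow> b \<in> vertices H \<Longrightarrow>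
                   {a, b} \<in> edges H \<longleftrightarrow> {\<sigma> a, \<sigma> b} \<in> edges H"
    using \<sigma> unfolding twin_retraction_def by blast+
  have \<phi>: "bij_betw \<phi> V W"
    using iso by (simp add: sgraph_iso_def induced_sgraph_def)
  then have \<phi>W: "\<And>f. f \<in> V \<Longrightarrow> \<phi> f \<in> W" and \<phi>_inj: "inj_on \<phi> V"
    and \<phi>_surj: "\<And>g. g \<in> W \<Longrightarrow> \<exists>f\<in>V. \<phi> f = g"
    by (auto simp: bij_betw_def)
  have \<phi>_edge: "{f, g} \<in> edges G \<longleftrightarrow> {\<phi> f, \<phi> g} \<in> edges H" if "f \<in> V" "g \<in> V" for f g
    using iso that \<phi>W by (simp add: sgraph_iso_def induced_sgraph_def)
  define F where "F f = {a \<in> vertices G. \<rho> a = f}" for f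
  define F' where "F' g = {b \<in> vertices H. \<sigma> b = g}" for g
  have "\<exists>h. bij_betw h (F f) (F' (\<phi> f)) \<and> h f = \<phi> f" if f: "f \<in> V" for f
  proof (rule eqpoll_imp_pointed_bij_betw)
    show "F f \<approx> F' (\<phi> f)" using fibres[OF f] by (simp add: F_def F'_def)
    show "f \<in> F f" using f VG \<rho>_id by (auto simp: F_def)
    show "\<phi> f \<in> F' (\<phi> f)" using \<phi>W[OF f] WH \<sigma>_id by (auto simp: F'_def)
  qed
  then obtain \<beta> where \<beta>: "\<And>f. f \<in> V \<Longrightarrow> bij_betw (\<beta> f) (F f) (F' (\<phi> f))"
    and \<beta>_base: "\<And>f. f \<in> V \<Longrightarrow> \<beta> f f = \<phi> f"
    by metis
  define \<psi> where "\<psi> a = \<beta> (\<rho> a) a" for a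
  have \<psi>_mem: "\<psi> a \<in> vertices H \<and> \<sigma> (\<psi> a) = \<phi> (\<rho> a)" if a: "a \<in> vertices G" for a
  proof -
    have "a \<in> F (\<rho> a)" using a by (simp add: F_def)
    then have "\<psi> a \<in> F' (\<phi> (\<rho> a))"
      unfolding \<psi>_def using \<beta>[OF \<rho>V[OF a]] by (rule bij_betwE[rule_format, rotated])
    then show ?thesis by (simp add: F'_def)
  qed
  have "inj_on \<psi> (vertices G)"
  proof (rule inj_onI)
    fix a b assume a: "a \<in> vertices G" and b: "b \<in> vertices G" and eq: "\<psi> a = \<psi> b"
    have "\<phi> (\<rho> a) = \<phi> (\<rho> b)" using \<psi>_mem[OF a] \<psi>_mem[OF b] eq by metis
    then have same: "\<rho> a = \<rho> b" using \<phi>_inj \<rho>V[OF a] \<rho>V[OF b] by (auto dest: inj_onD)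
    have "inj_on (\<beta> (\<rho> a)) (F (\<rho> a))" using \<beta>[OF \<rho>V[OF a]] by (simp add: bij_betw_def)
    moreover have "a \<in> F (\<rho> a)" "b \<in> F (\<rho> a)" using a b same by (simp_all add: F_def)
    ultimately show "a = b" using eq same by (auto simp: \<psi>_def dest: inj_onD)
  qed
  moreover have "\<psi> ` vertices G = vertices H"
  proof
    show "\<psi> ` vertices G \<subseteq> vertices H" using \<psi>_mem by blast
    show "vertices H \<subseteq> \<psi> ` vertices G"
    proof
      fix b assume b: "b \<in> vertices H"
      obtain f where f: "f \<in> V" "\<phi> f = \<sigma> b" using \<phi>_surj[OF \<sigma>W[OF b]] by blast
      have "b \<in> F' (\<phi> f)" using b f by (simp add: F'_def)
      then have "b \<in> \<beta> f ` F f" using \<beta>[OF f(1)] by (simp add: bij_betw_def)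
      then show "b \<in> \<psi> ` vertices G" by (auto simp: F_def \<psi>_def)
    qed
  qed
  moreover have "{a, b} \<in> edges G \<longleftrightarrow> {\<psi> a, \<psi> b} \<in> edges H"
    if a: "a \<in> vertices G" and b: "b \<in> vertices G" for a b
    using \<rho>_edge[OF a b] \<phi>_edge[OF \<rho>V[OF a] \<rho>V[OF b]] \<psi>_mem[OF a] \<psi>_mem[OF b]
      \<sigma>_edge[of "\<psi> a" "\<psi> b"] by simp
  ultimately have "sgraph_iso G H \<psi>"
    by (simp add: sgraph_iso_def bij_betw_def)
  moreover have "\<forall>f\<in>V. \<psi> f = \<phi> f"
    by (simp add: \<psi>_def \<rho>_id \<beta>_base)
  ultimately show ?thesis by blast
qed


section \<open>Annihilators and zero sets\<close>

lemma carrier_CP_ring [simp]: "carrier (CP_ring X P) = CP X P"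
  by (simp add: CP_ring_def)

lemma zero_CP_ring: "\<zero>\<^bsub>CP_ring X P\<^esub> = (\<lambda>x\<in>topspace X. 0)"
  by (simp add: CP_ring_def)

lemma mult_CP_ring: "f \<otimes>\<^bsub>CP_ring X P\<^esub> g = (\<lambda>x\<in>topspace X. f x * g x)"
  by (simp add: CP_ring_def)

lemma CP_eq_zero_iff:
  assumes "f \<in> CP X P"
  shows "f = \<zero>\<^bsub>CP_ring X P\<^esub> \<longleftrightarrow> zero_set X f = topspace X"
  using assms
  by (auto simp: zero_CP_ring CP_def cont_functions_def zero_set_def fun_eq_iff extensional_def)

lemma CP_mult_eq_zero_iff:
  "f \<otimes>\<^bsub>CP_ring X P\<^esub> g = \<zero>\<^bsub>CP_ring X P\<^esub> \<longleftrightarrow> (\<forall>x\<in>topspace X. f x = 0 \<or> g x = 0)"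
  by (auto simp: zero_CP_ring mult_CP_ring fun_eq_iff restrict_def)

text \<open>The cozero set of \<open>r\<close> witnesses at each of its own points that the point belongs to
  \<^term>\<open>ideal_points X P\<close>, and being open it lies in any interior once it lies in the set. The
  left-hand side thus depends on \<open>f\<close> only through the open set that defines its class.\<close>

lemma annihilator_CP_ring_iff:
  assumes r: "r \<in> CP X P"
  shows "r \<in> annihilator (CP_ring X P) f \<longleftrightarrow>
           topspace X - zero_set X r \<subseteq> X interior_of (zero_set X f) \<inter> ideal_points X P"
    (is "_ \<longleftrightarrow> ?C \<subseteq> _")
proof -
  have "continuous_map X euclideanreal r" using r by (simp add: CP_def cont_functions_def)
  then have "closedin X {x \<in> topspace X. r x \<in> {0}}"
    by (rule closedin_continuous_map_preimage) simp
  then have op: "openin X ?C" by (simp add: zero_set_def openin_diff)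
  have "X closure_of ?C \<in> P" using r by (simp add: CP_def)
  with op have "?C \<subseteq> ideal_points X P" by (auto simp: ideal_points_def)
  then have "?C \<subseteq> X interior_of (zero_set X f) \<inter> ideal_points X P \<longleftrightarrow> ?C \<subseteq> zero_set X f"
    using op interior_of_subset[of X "zero_set X f"] interior_of_maximal[of ?C] by blast
  also have "\<dots> \<longleftrightarrow> r \<in> annihilator (CP_ring X P) f"
    using r by (auto simp: annihilator_def CP_mult_eq_zero_iff zero_set_def)
  finally show ?thesis by simp
qed

lemma CP_equiv_imp_annihilator_eq:
  assumes "(f, g) \<in> CP_equiv X P"
  shows "annihilator (CP_ring X P) f = annihilator (CP_ring X P) g"
proof -
  have "r \<in> annihilator (CP_ring X P) f \<longleftrightarrow> r \<in> annihilator (CP_ring X P) g"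
    if "r \<in> CP X P" for r
    using assms that by (simp add: annihilator_CP_ring_iff CP_equiv_def)
  then show ?thesis by (auto simp: annihilator_def)
qed


section \<open>Adjacency depends only on annihilators\<close>

text \<open>Move one factor at a time: \<open>r\<close> kills \<open>a b\<close> if and only if \<open>r a\<close> kills \<open>b\<close>, and this only
  depends on the annihilator of \<open>b\<close>.\<close>

lemma annihilator_CP_mult_cong:
  assumes P: "closed_set_ideal X P" and a: "a \<in> CP X P" and b: "b \<in> CP X P"
    and aa: "annihilator (CP_ring X P) a = annihilator (CP_ring X P) a'"
    and bb: "annihilator (CP_ring X P) b = annihilator (CP_ring X P) b'"
    and a': "a' \<in> CP X P" and b': "b' \<in> CP X P"
  shows "annihilator (CP_ring X P) (a \<otimes>\<^bsub>CP_ring X P\<^esub> b)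
       = annihilator (CP_ring X P) (a' \<otimes>\<^bsub>CP_ring X P\<^esub> b')"
proof -
  let ?R = "CP_ring X P"
  have move: "r \<in> annihilator ?R (c \<otimes>\<^bsub>?R\<^esub> d) \<longleftrightarrow> r \<otimes>\<^bsub>?R\<^esub> c \<in> annihilator ?R d"
    if "r \<in> CP X P" "c \<in> CP X P" "d \<in> CP X P" for r c d
    using that CP_ring_mult(1,3)[OF P, of r c d] by (simp add: annihilator_def)
  have swap: "c \<otimes>\<^bsub>?R\<^esub> d = d \<otimes>\<^bsub>?R\<^esub> c" if "c \<in> CP X P" "d \<in> CP X P" for c d
    using that CP_ring_mult(2)[OF P, of c d] by simp
  have "r \<in> annihilator ?R (a \<otimes>\<^bsub>?R\<^esub> b) \<longleftrightarrow> r \<in> annihilator ?R (a' \<otimes>\<^bsub>?R\<^esub> b')"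
    if r: "r \<in> CP X P" for r
    using move[OF r a b] move[OF r a b'] move[OF r b' a] move[OF r b' a']
      swap[OF a b'] swap[OF a' b'] aa bb by simp
  then show ?thesis by (auto simp: annihilator_def)
qed

lemma annihilator_CP_square:
  "annihilator (CP_ring X P) (a \<otimes>\<^bsub>CP_ring X P\<^esub> a) = annihilator (CP_ring X P) a"
  unfolding annihilator_def CP_mult_eq_zero_iff by (auto simp: mult_CP_ring)

text \<open>When \<open>a = b\<close> both sides are false: there are no loops, and the ring is reduced, so
  \<open>a\<close> and its square have the same annihilator. Because this criterion also covers equal ends, it
  can be transported to representatives even when the two ends collapse to one function.\<close>

lemma annihilator_graph_edge_iff:
  assumes P: "closed_set_ideal X P"
    and a: "a \<in> nonzero_zero_divisors (CP_ring X P)" and b: "b \<in> nonzero_zero_divisors (CP_ring X P)"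
  shows "{a, b} \<in> edges (annihilator_graph (CP_ring X P)) \<longleftrightarrow>
           annihilator (CP_ring X P) a \<union> annihilator (CP_ring X P) b
             \<noteq> annihilator (CP_ring X P) (a \<otimes>\<^bsub>CP_ring X P\<^esub> b)" (is "_ \<longleftrightarrow> ?N a b")
proof -
  have aC: "a \<in> CP X P" and bC: "b \<in> CP X P"
    using a b by (auto simp: nonzero_zero_divisors_def)
  have "?N b a \<longleftrightarrow> ?N a b"
    using CP_ring_mult(2)[OF P, of a b] aC bC by (simp add: Un_commute)
  moreover have "a \<noteq> b" if "?N a b"
    using that annihilator_CP_square[of X P a] by auto
  ultimately show ?thesis
    using a b by (auto simp: annihilator_graph_def doubleton_eq_iff)
qed

lemma nonzero_zero_divisors_CP_cong:
  assumes P: "closed_set_ideal X P" and a: "a \<in> nonzero_zero_divisors (CP_ring X P)"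
    and eq: "annihilator (CP_ring X P) a = annihilator (CP_ring X P) b" and b: "b \<in> CP X P"
  shows "b \<in> nonzero_zero_divisors (CP_ring X P)"
proof -
  let ?R = "CP_ring X P"
  obtain c where aC: "a \<in> CP X P" and a0: "a \<noteq> \<zero>\<^bsub>?R\<^esub>"
    and c: "c \<in> CP X P" "c \<noteq> \<zero>\<^bsub>?R\<^esub>" "a \<otimes>\<^bsub>?R\<^esub> c = \<zero>\<^bsub>?R\<^esub>"
    using a by (auto simp: nonzero_zero_divisors_def)
  have "c \<in> annihilator ?R a"
    using c by (auto simp: annihilator_def CP_mult_eq_zero_iff)
  then have "b \<otimes>\<^bsub>?R\<^esub> c = \<zero>\<^bsub>?R\<^esub>"
    unfolding eq by (auto simp: annihilator_def CP_mult_eq_zero_iff)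
  moreover have "b \<noteq> \<zero>\<^bsub>?R\<^esub>"
  proof
    \<comment> \<open>Otherwise \<open>a\<close>, like everything else, kills \<open>b\<close>, hence kills itself, and \<open>a\<close> is zero.\<close>
    assume "b = \<zero>\<^bsub>?R\<^esub>"
    then have "a \<in> annihilator ?R a"
      unfolding eq using aC by (auto simp: annihilator_def mult_CP_ring zero_CP_ring)
    then have "zero_set X a = topspace X"
      by (auto simp: annihilator_def CP_mult_eq_zero_iff zero_set_def)
    then show False using a0 CP_eq_zero_iff[OF aC] by simp
  qed
  ultimately show ?thesis using b c by (auto simp: nonzero_zero_divisors_def)
qed


section \<open>Retraction onto the class representatives\<close>

definition CP_representative ::
  "'a topology \<Rightarrow> 'a set set \<Rightarrow> ('a \<Rightarrow> real) set \<Rightarrow> ('a \<Rightarrow> real) \<Rightarrow> ('a \<Rightarrow> real)" where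
  "CP_representative X P S a = (THE f. f \<in> S \<and> f \<in> CP_class X P a)"

lemma CP_representative:
  assumes S: "CP_transversal X P S" and a: "a \<in> CP X P"
  shows "CP_representative X P S a \<in> S" and "(a, CP_representative X P S a) \<in> CP_equiv X P"
    and "\<And>f. f \<in> S \<Longrightarrow> (a, f) \<in> CP_equiv X P \<Longrightarrow> CP_representative X P S a = f"
proof -
  have "CP_class X P a \<in> CP X P // CP_equiv X P"
    using a by (simp add: CP_class_def quotientI)
  then have ex1: "\<exists>!f. f \<in> S \<and> f \<in> CP_class X P a"
    using S by (simp add: CP_transversal_def)
  from theI'[OF ex1] show "CP_representative X P S a \<in> S"
    and "(a, CP_representative X P S a) \<in> CP_equiv X P"
    by (simp_all add: CP_representative_def CP_class_def)
  fix f assume "f \<in> S" "(a, f) \<in> CP_equiv X P"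
  then show "CP_representative X P S a = f"
    unfolding CP_representative_def using ex1 by (intro the1_equality) (simp_all add: CP_class_def)
qed

text \<open>A nonzero \<open>b\<close> killing \<open>f\<close> has a nonempty cozero set, which lies in the open set defining the
  class of \<open>f\<close>.\<close>

lemma transversal_zero_divisor_in_CP_vertices:
  assumes f: "f \<in> nonzero_zero_divisors (CP_ring X P)" and "f \<in> S"
  shows "f \<in> CP_vertices X P S"
proof -
  let ?R = "CP_ring X P"
  obtain b where f0: "f \<noteq> \<zero>\<^bsub>?R\<^esub>" and b: "b \<in> CP X P" "b \<noteq> \<zero>\<^bsub>?R\<^esub>" "f \<otimes>\<^bsub>?R\<^esub> b = \<zero>\<^bsub>?R\<^esub>"
    using f by (auto simp: nonzero_zero_divisors_def)
  have "b \<in> annihilator ?R f"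
    using b by (auto simp: annihilator_def CP_mult_eq_zero_iff)
  then have "topspace X - zero_set X b \<subseteq> X interior_of (zero_set X f) \<inter> ideal_points X P"
    using b(1) by (simp add: annihilator_CP_ring_iff)
  moreover have "topspace X - zero_set X b \<noteq> {}"
    using b CP_eq_zero_iff[OF b(1)] by (auto simp: zero_set_def)
  ultimately show ?thesis using \<open>f \<in> S\<close> f0 by (auto simp: CP_vertices_def)
qed

lemma twin_retraction_CP_representative:
  assumes X: "completely_regular_space X" and P: "closed_set_ideal X P"
    and S: "CP_transversal X P S"
  shows "twin_retraction (annihilator_graph (CP_ring X P)) (CP_vertices X P S)
           (CP_representative X P S)"
proof -
  let ?R = "CP_ring X P" and ?\<rho> = "CP_representative X P S"
  have sub: "CP_vertices X P S \<subseteq> nonzero_zero_divisors ?R"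
    by (rule CP_vertices_subset[OF X P S])
  have C: "a \<in> CP X P" if "a \<in> nonzero_zero_divisors ?R" for a
    using that by (simp add: nonzero_zero_divisors_def)
  have \<rho>C: "?\<rho> a \<in> CP X P" if "a \<in> nonzero_zero_divisors ?R" for a
    using CP_representative(2)[OF S C[OF that]] by (simp add: CP_equiv_def)
  have ann: "annihilator ?R a = annihilator ?R (?\<rho> a)" if "a \<in> nonzero_zero_divisors ?R" for a
    using CP_representative(2)[OF S C[OF that]] by (rule CP_equiv_imp_annihilator_eq)
  have zd: "?\<rho> a \<in> nonzero_zero_divisors ?R" if "a \<in> nonzero_zero_divisors ?R" for a
    using nonzero_zero_divisors_CP_cong[OF P that ann[OF that] \<rho>C[OF that]] .
  have "?\<rho> a \<in> CP_vertices X P S" if "a \<in> nonzero_zero_divisors ?R" for a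
    using transversal_zero_divisor_in_CP_vertices[OF zd[OF that] CP_representative(1)[OF S C[OF that]]] .
  moreover have "?\<rho> f = f" if f: "f \<in> CP_vertices X P S" for f
  proof -
    have fC: "f \<in> CP X P" using f sub C by blast
    moreover have "f \<in> S" using f by (simp add: CP_vertices_def)
    ultimately show ?thesis by (intro CP_representative(3)[OF S]) (auto simp: CP_equiv_def)
  qed
  moreover have "{a, b} \<in> edges (annihilator_graph ?R) \<longleftrightarrow> {?\<rho> a, ?\<rho> b} \<in> edges (annihilator_graph ?R)"
    if a: "a \<in> nonzero_zero_divisors ?R" and b: "b \<in> nonzero_zero_divisors ?R" for a b
    unfolding annihilator_graph_edge_iff[OF P a b] annihilator_graph_edge_iff[OF P zd[OF a] zd[OF b]]
      annihilator_CP_mult_cong[OF P C[OF a] C[OF b] ann[OF a] ann[OF b] \<rho>C[OF a] \<rho>C[OF b]]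
    using ann[OF a] ann[OF b] by simp
  ultimately show ?thesis
    using sub by (simp add: twin_retraction_def annihilator_graph_def)
qed

lemma fibre_CP_representative:
  assumes X: "completely_regular_space X" and P: "closed_set_ideal X P"
    and S: "CP_transversal X P S" and f: "f \<in> CP_vertices X P S"
  shows "{a \<in> vertices (annihilator_graph (CP_ring X P)). CP_representative X P S a = f}
       = CP_class X P f"
proof -
  let ?R = "CP_ring X P"
  have fS: "f \<in> S" using f by (simp add: CP_vertices_def)
  have fZ: "f \<in> nonzero_zero_divisors ?R"
    using CP_vertices_subset[OF X P S] f by blast
  have "a \<in> nonzero_zero_divisors ?R \<and> CP_representative X P S a = f \<longleftrightarrow> (f, a) \<in> CP_equiv X P" for a
  proof
    assume "a \<in> nonzero_zero_divisors ?R \<and> CP_representative X P S a = f"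
    then have "(a, f) \<in> CP_equiv X P"
      using CP_representative(2)[OF S, of a] by (auto simp: nonzero_zero_divisors_def)
    then show "(f, a) \<in> CP_equiv X P" by (auto simp: CP_equiv_def)
  next
    assume fa: "(f, a) \<in> CP_equiv X P"
    then have aC: "a \<in> CP X P" and af: "(a, f) \<in> CP_equiv X P" by (auto simp: CP_equiv_def)
    have "a \<in> nonzero_zero_divisors ?R"
      using nonzero_zero_divisors_CP_cong[OF P fZ CP_equiv_imp_annihilator_eq[OF fa] aC] .
    then show "a \<in> nonzero_zero_divisors ?R \<and> CP_representative X P S a = f"
      using CP_representative(3)[OF S aC fS af] by simp
  qed
  then show ?thesis by (auto simp: CP_class_def annihilator_graph_def)
qed


section \<open>Extending isomorphisms\<close>

theorem theorem6p3:
  fixes X :: "'a topology" and Y :: "'b topology"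
    and P :: "'a set set" and Q :: "'b set set"
    and S :: "('a \<Rightarrow> real) set" and T :: "('b \<Rightarrow> real) set"
    and \<phi> :: "('a \<Rightarrow> real) \<Rightarrow> ('b \<Rightarrow> real)"
  assumes "completely_regular_space X" and "Hausdorff_space X"
    and "completely_regular_space Y" and "Hausdorff_space Y"
    and "closed_set_ideal X P" and "closed_set_ideal Y Q"
    and "CP_transversal X P S" and "CP_transversal Y Q T"
    and "sgraph_iso (CP_graph X P S) (CP_graph Y Q T) \<phi>"
    and "\<And>f. f \<in> CP_vertices X P S \<Longrightarrow> CP_class X P f \<approx> CP_class Y Q (\<phi> f)"
  shows "\<exists>\<psi>. sgraph_iso (annihilator_graph (CP_ring X P)) (annihilator_graph (CP_ring Y Q)) \<psi> \<and>
             (\<forall>f \<in> CP_vertices X P S. \<psi> f = \<phi> f)"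
proof (rule sgraph_iso_extend_along_twin_retractions)
  show "twin_retraction (annihilator_graph (CP_ring X P)) (CP_vertices X P S)
          (CP_representative X P S)"
    using assms(1,5,7) by (rule twin_retraction_CP_representative)
  show "twin_retraction (annihilator_graph (CP_ring Y Q)) (CP_vertices Y Q T)
          (CP_representative Y Q T)"
    using assms(3,6,8) by (rule twin_retraction_CP_representative)
  show iso: "sgraph_iso (induced_sgraph (annihilator_graph (CP_ring X P)) (CP_vertices X P S))
          (induced_sgraph (annihilator_graph (CP_ring Y Q)) (CP_vertices Y Q T)) \<phi>"
    using assms(9) by (simp add: CP_graph_def)
  fix f assume f: "f \<in> CP_vertices X P S"
  then have \<phi>f: "\<phi> f \<in> CP_vertices Y Q T"
    using iso by (auto simp: sgraph_iso_def induced_sgraph_def bij_betw_def)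
  show "{a \<in> vertices (annihilator_graph (CP_ring X P)). CP_representative X P S a = f}
      \<approx> {b \<in> vertices (annihilator_graph (CP_ring Y Q)). CP_representative Y Q T b = \<phi> f}"
    unfolding fibre_CP_representative[OF assms(1,5,7) f]
      fibre_CP_representative[OF assms(3,6,8) \<phi>f]
    using f by (rule assms(10))
qed

end
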